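(* Let $X$ be an infinite dimensional complex Banach space and let $V\in\mathcal L(X)$ be any non-nilpotent quasinilpotent operator. Then, corresponding to $V$, there exists a rank one operator $Q\in\mathcal L(X)$ with $Q^2=0$ such that $$\#\sigma(V+\alpha Q)=\infty$$ for all non-zero $\alpha\in\mathbb C$ with at most one exception.
   Context: $\mathcal L(X)$ denotes the Banach algebra of continuous linear operators on $X$. For $T\in\mathcal L(X)$, $\sigma(T)=\{\lambda\in\mathbb C:\lambda I-T \text{ is not invertible in }\mathcal L(X)\}$ is the spectrum of $T$. The operator $V$ is quasinilpotent if $\sigma(V)=\{0\}$, and non-nilpotent if $V^k\neq 0$ for all $k\ge 1$. For a set $K$, $\#K$ denotes the number of distinct elements of $K$. *)

theory Defs
  imports "HOL-Analysis.Analysis"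
begin

text \<open>The library has only real normed spaces. A complex one is a real one together with a complex
  scalar multiplication that extends the real one and is compatible with the norm.\<close>

class complex_vector = real_vector +
  fixes scaleC :: "complex \<Rightarrow> 'a \<Rightarrow> 'a"  (infixr "*\<^sub>C" 75)
  assumes scaleC_add_right: "a *\<^sub>C (x + y) = a *\<^sub>C x + a *\<^sub>C y"
    and scaleC_add_left: "(a + b) *\<^sub>C x = a *\<^sub>C x + b *\<^sub>C x"
    and scaleC_scaleC: "a *\<^sub>C b *\<^sub>C x = (a * b) *\<^sub>C x"
    and scaleC_one: "1 *\<^sub>C x = x"
    and scaleC_of_real: "complex_of_real r *\<^sub>C x = r *\<^sub>R x"

class complex_normed_vector = complex_vector + real_normed_vector +
  assumes norm_scaleC: "norm (a *\<^sub>C x) = cmod a * norm x"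

class complex_banach = complex_normed_vector + banach

global_interpretation complex_vector:
  vector_space "scaleC :: complex \<Rightarrow> 'a \<Rightarrow> 'a::complex_vector"
  by standard (simp_all add: scaleC_add_right scaleC_add_left scaleC_scaleC scaleC_one)

definition infinite_dimensional :: "'a::complex_vector itself \<Rightarrow> bool" where
  "infinite_dimensional _ \<longleftrightarrow> \<not> (\<exists>B::'a set. finite B \<and> complex_vector.span B = UNIV)"

definition cont_linear_ops :: "('a::complex_normed_vector \<Rightarrow> 'a) set" where
  "cont_linear_ops = {T. Vector_Spaces.linear scaleC scaleC T \<and> continuous_on UNIV T}"

definition invertible_op :: "('a::complex_normed_vector \<Rightarrow> 'a) \<Rightarrow> bool" where
  "invertible_op T \<longleftrightarrow>
     T \<in> cont_linear_ops \<and> (\<exists>S\<in>cont_linear_ops. S \<circ> T = id \<and> T \<circ> S = id)"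

definition spectrum_op :: "('a::complex_normed_vector \<Rightarrow> 'a) \<Rightarrow> complex set" where
  "spectrum_op T = {l. \<not> invertible_op (\<lambda>x. l *\<^sub>C x - T x)}"

definition quasinilpotent :: "('a::complex_normed_vector \<Rightarrow> 'a) \<Rightarrow> bool" where
  "quasinilpotent T \<longleftrightarrow> spectrum_op T = {0}"

definition nilpotent_op :: "('a::complex_normed_vector \<Rightarrow> 'a) \<Rightarrow> bool" where
  "nilpotent_op T \<longleftrightarrow> (\<exists>k\<ge>1. T ^^ k = (\<lambda>x. 0))"

definition rank_one :: "('a::complex_normed_vector \<Rightarrow> 'a) \<Rightarrow> bool" where
  "rank_one T \<longleftrightarrow> complex_vector.dim (range T) = 1"

lemma cont_linear_ops_iff:
  "T \<in> cont_linear_ops \<longleftrightarrow> bounded_linear T \<and> (\<forall>a x. T (a *\<^sub>C x) = a *\<^sub>C T x)"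
proof
  assume "T \<in> cont_linear_ops"
  then have lin: "Vector_Spaces.linear scaleC scaleC T" and cont: "continuous_on UNIV T"
    by (auto simp: cont_linear_ops_def)
  interpret T: Vector_Spaces.linear scaleC scaleC T by (fact lin)
  have "isCont T 0"
    using cont by (simp add: continuous_on_eq_continuous_at)
  then obtain d where d: "d > 0" "\<And>y. norm y < d \<Longrightarrow> norm (T y) < 1"
    using T.zero by (auto simp: continuous_at_eps_delta dist_norm dest!: spec[of _ 1])
  have "norm (T x) \<le> norm x * (2 / d)" for x
  proof (cases "x = 0")
    case False
    let ?r = "d / (2 * norm x)"
    have "norm (?r *\<^sub>R x) < d"
      using d(1) False by simp
    then have "norm (T (?r *\<^sub>R x)) < 1"
      by (rule d(2))
    also have "T (?r *\<^sub>R x) = ?r *\<^sub>R T x"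
      by (metis T.scale scaleC_of_real)
    finally show ?thesis
      using d(1) False by (simp add: field_simps)
  qed (simp add: T.zero)
  then have "bounded_linear T"
    by (intro bounded_linear_intro[where K = "2 / d"]) (auto simp: T.add T.scale simp flip: scaleC_of_real)
  then show "bounded_linear T \<and> (\<forall>a x. T (a *\<^sub>C x) = a *\<^sub>C T x)"
    by (simp add: T.scale)
next
  assume T: "bounded_linear T \<and> (\<forall>a x. T (a *\<^sub>C x) = a *\<^sub>C T x)"
  then interpret bounded_linear T by simp
  have "Vector_Spaces.linear scaleC scaleC T"
    by unfold_locales (use T add in auto)
  then show "T \<in> cont_linear_ops"
    by (simp add: cont_linear_ops_def linear_continuous_on bounded_linear_axioms)
qed

end

(* For Q y = f(y) x with f(x) = 0, a point l = 1/z lies in the spectrum of V + a Q as soon as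
   a g(z) = 1, where g(z) = z f((I - z V)^-1 x) = sum of f(V^n x) z^(n+1). Quasinilpotency makes g
   entire, and by the great Picard theorem a transcendental entire function takes every value, with
   at most one exception, infinitely often. So it suffices that f(x) = 0 and f(V^n x) is nonzero for
   all n >= 1. By Baire's theorem some x has V^n x nonzero for all n; no V^n x with n >= 1 is then a
   multiple of x, as V^n has no nonzero eigenvalue. Baire's theorem in the dual space, which
   Hahn-Banach shows to separate points, yields f. *)
theory Submission
  imports Defs "HOL-Complex_Analysis.Complex_Analysis"
begin

subsection \<open>Separating functionals\<close>

definition sublinear :: "('a::real_vector \<Rightarrow> real) \<Rightarrow> bool" where
  "sublinear p \<longleftrightarrow> (\<forall>x y. p (x + y) \<le> p x + p y) \<and> (\<forall>c\<ge>0. \<forall>x. p (c *\<^sub>R x) = c * p x)"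

text \<open>One inequality suffices for homogeneity: applying it to the vector
  \<open>c *\<^sub>R x\<close> with factor \<open>inverse c\<close> gives the reverse one.\<close>

lemma sublinearI:
  assumes "\<And>x y. p (x + y) \<le> p x + p y" "p 0 = 0"
    and le: "\<And>c x. c > 0 \<Longrightarrow> p (c *\<^sub>R x) \<le> c * p x"
  shows "sublinear p"
proof -
  have "p (c *\<^sub>R x) = c * p x" if "c > 0" for c x
  proof (rule antisym)
    have "p (inverse c *\<^sub>R c *\<^sub>R x) \<le> inverse c * p (c *\<^sub>R x)"
      using that by (intro le) simp
    then show "c * p x \<le> p (c *\<^sub>R x)"
      using that by (simp add: field_simps)
  qed (use that le in simp)
  then have "p (c *\<^sub>R x) = c * p x" if "c \<ge> 0" for c x
    using that assms(2) by (cases "c = 0") auto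
  then show ?thesis
    using assms(1) by (simp add: sublinear_def)
qed

lemma sublinear_zero: "sublinear p \<Longrightarrow> p 0 = 0"
  unfolding sublinear_def by (metis mult_zero_left order_refl scaleR_zero_left)

lemma sublinear_minus: "sublinear p \<Longrightarrow> - p (- x) \<le> p x"
proof -
  assume p: "sublinear p"
  then have "p (x + - x) \<le> p x + p (- x)"
    unfolding sublinear_def by blast
  then show ?thesis
    using sublinear_zero[OF p] by simp
qed

text \<open>A sublinear \<open>p\<close> that is minimal equals this \<open>q\<close>, so it is also superadditive: this replaces the
  one-step extension in the proof of the Hahn-Banach theorem.\<close>

lemma sublinear_slope:
  fixes p :: "'a::real_vector \<Rightarrow> real"
  assumes p: "sublinear p"
  shows "\<exists>q. sublinear q \<and> q \<le> p \<and> (\<forall>x. q x \<le> p (x + y) - p y)"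
proof -
  \<comment> \<open>The infimum over all \<open>t \<ge> 0\<close>, not the single value at
    \<open>t = 1\<close>, makes \<open>q\<close> sublinear. The value at \<open>t = 0\<close> gives
    \<open>q \<le> p\<close>, the one at \<open>t = 1\<close> the slope bound.\<close>
  define A where "A x t = p (x + t *\<^sub>R y) - t * p y" for x t
  define q where "q x = (INF t\<in>{0..}. A x t)" for x
  have add: "p (a + b) \<le> p a + p b" and scale: "c \<ge> 0 \<Longrightarrow> p (c *\<^sub>R a) = c * p a" for a b c
    using p by (auto simp: sublinear_def)
  \<comment> \<open>A bound independent of \<open>t\<close> makes the real infimum a genuine
    one.\<close>
  have lower: "- p (- x) \<le> A x t" if "t \<ge> 0" for x t
    using add[of "x + t *\<^sub>R y" "- x"] scale[of t y] that by (simp add: A_def)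
  have q_le: "q x \<le> A x t" if "t \<ge> 0" for x t
    unfolding q_def using that lower by (intro cINF_lower bdd_belowI2[where m = "- p (- x)"]) auto
  have q_greatest: "b \<le> q x" if "\<And>t. t \<ge> 0 \<Longrightarrow> b \<le> A x t" for b x
    unfolding q_def using that by (intro cINF_greatest) auto
  have "sublinear q"
  proof (rule sublinearI)
    fix x x'
    have *: "q (x + x') \<le> A x t + A x' s" if "t \<ge> 0" "s \<ge> 0" for t s
    proof -
      have "q (x + x') \<le> A (x + x') (t + s)"
        using that by (intro q_le) simp
      also have "\<dots> \<le> A x t + A x' s"
        using add[of "x + t *\<^sub>R y" "x' + s *\<^sub>R y"] by (simp add: A_def algebra_simps)
      finally show ?thesis .
    qed
    have "q (x + x') - A x t \<le> q x'" if "t \<ge> 0" for t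
      using *[OF that] by (intro q_greatest) (simp add: algebra_simps)
    then have "q (x + x') - q x' \<le> q x"
      by (intro q_greatest) (simp add: algebra_simps)
    then show "q (x + x') \<le> q x + q x'"
      by simp
  next
    have "A 0 t = 0" if "t \<ge> 0" for t
      using scale[OF that] by (simp add: A_def)
    then show "q 0 = 0"
      by (simp add: q_def)
  next
    fix c :: real and x
    assume c: "c > 0"
    have "q (c *\<^sub>R x) / c \<le> q x"
    proof (rule q_greatest)
      fix t :: real assume t: "t \<ge> 0"
      \<comment> \<open>Scaling the vector by \<open>c\<close> is matched by scaling the parameter
        by \<open>c\<close>.\<close>
      have "q (c *\<^sub>R x) \<le> A (c *\<^sub>R x) (c * t)"
        using c t by (intro q_le) simp
      also have "\<dots> = c * A x t"
        using scale[of c "x + t *\<^sub>R y"] c by (simp add: A_def algebra_simps)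
      finally show "q (c *\<^sub>R x) / c \<le> A x t"
        using c by (simp add: field_simps)
    qed
    then show "q (c *\<^sub>R x) \<le> c * q x"
      using c by (simp add: field_simps)
  qed
  moreover have "q x \<le> p x" "q x \<le> p (x + y) - p y" for x
    using q_le[of 0 x] q_le[of 1 x] by (simp_all add: A_def)
  ultimately show ?thesis
    by (auto simp: le_fun_def)
qed

text \<open>Zorn's lemma, used downwards: the pointwise infimum of a nonempty chain is again
  sublinear.\<close>

lemma minimal_sublinear_exists:
  fixes p :: "'a::real_vector \<Rightarrow> real"
  assumes p: "sublinear p"
  shows "\<exists>m. sublinear m \<and> m \<le> p \<and> (\<forall>q. sublinear q \<and> q \<le> m \<longrightarrow> q = m)"
proof -
  \<comment> \<open>The order \<open>?P\<close> is reversed, so that a maximal element is a minimal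
    functional.\<close>
  let ?A = "{q. sublinear q \<and> q \<le> p}" and ?P = "\<lambda>q r :: 'a \<Rightarrow> real. r \<le> q"
  have "\<exists>m\<in>?A. \<forall>q\<in>?A. ?P m q \<longrightarrow> q = m"
  proof (rule predicate_Zorn)
    show "partial_order_on ?A (relation_of ?P ?A)"
      by (rule partial_order_on_relation_ofI) auto
  next
    fix C assume C: "C \<in> Chains (relation_of ?P ?A)"
    show "\<exists>u\<in>?A. \<forall>q\<in>C. u \<le> q"
    \<comment> \<open>For the empty chain, \<open>p\<close> itself serves as the bound.\<close>
    proof (cases "C = {}")
      case False
      have CA: "sublinear q" "q \<le> p" if "q \<in> C" for q
        using C that by (auto simp: Chains_def relation_of_def)
      have total: "q \<le> r \<or> r \<le> q" if "q \<in> C" "r \<in> C" for q r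
        using C that by (auto simp: Chains_def relation_of_def)
      define u where "u x = (INF q\<in>C. q x)" for x
      \<comment> \<open>Since \<open>- p (- x) \<le> - q (- x) \<le> q x\<close>, the chain is
        bounded below at each point.\<close>
      have lower: "- p (- x) \<le> q x" if "q \<in> C" for q x
        using sublinear_minus[OF CA(1)[OF that], of x] CA(2)[OF that] by (simp add: le_fun_def) (meson neg_le_iff_le order_trans)
      have u_le: "u x \<le> q x" if "q \<in> C" for q x
        unfolding u_def using that lower by (intro cINF_lower bdd_belowI2[where m = "- p (- x)"]) auto
      have u_greatest: "b \<le> u x" if "\<And>q. q \<in> C \<Longrightarrow> b \<le> q x" for b x
        unfolding u_def using that False by (intro cINF_greatest) auto
      have "sublinear u"
      proof (rule sublinearI)
        fix x y
        \<comment> \<open>Infima of sublinear functions need not be subadditive. In a chain, the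
          smaller of \<open>q\<close> and \<open>r\<close> controls both terms.\<close>
        have *: "u (x + y) \<le> q x + r y" if qr: "q \<in> C" "r \<in> C" for q r
        proof -
          obtain s where s: "s \<in> C" "s \<le> q" "s \<le> r"
            using total[OF qr] qr by auto
          have "u (x + y) \<le> s (x + y)"
            by (rule u_le) fact
          also have "\<dots> \<le> s x + s y"
            using CA(1)[OF s(1)] by (simp add: sublinear_def)
          also have "\<dots> \<le> q x + r y"
            using s by (simp add: le_fun_def add_mono)
          finally show ?thesis .
        qed
        have "u (x + y) - q x \<le> u y" if "q \<in> C" for q
          using *[OF that] by (intro u_greatest) (simp add: algebra_simps)
        then have "u (x + y) - u y \<le> u x"
          by (intro u_greatest) (simp add: algebra_simps)
        then show "u (x + y) \<le> u x + u y"
          by simp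
      next
        show "u 0 = 0"
          using False CA(1) by (simp add: u_def sublinear_zero)
      next
        fix c :: real and x assume c: "c > 0"
        have "u (c *\<^sub>R x) / c \<le> u x"
        proof (rule u_greatest)
          fix q assume q: "q \<in> C"
          have "u (c *\<^sub>R x) \<le> c * q x"
            using u_le[OF q, of "c *\<^sub>R x"] CA(1)[OF q] c by (simp add: sublinear_def)
          then show "u (c *\<^sub>R x) / c \<le> q x"
            using c by (simp add: field_simps)
        qed
        then show "u (c *\<^sub>R x) \<le> c * u x"
          using c by (simp add: field_simps)
      qed
      moreover have "u \<le> q" if "q \<in> C" for q
        using u_le[OF that] by (simp add: le_fun_def)
      ultimately show ?thesis
        using False CA(2) by (metis (mono_tags, lifting) all_not_in_conv mem_Collect_eq order_trans)
    qed (use p in auto)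
  qed
  then obtain m where m: "sublinear m" "m \<le> p"
    and min: "\<And>q. sublinear q \<Longrightarrow> q \<le> p \<Longrightarrow> q \<le> m \<Longrightarrow> q = m"
    by auto
  have "q = m" if "sublinear q" "q \<le> m" for q
    using that order_trans[OF that(2) m(2)] by (intro min)
  with m show ?thesis
    by (intro exI[of _ m]) auto
qed

text \<open>The slope construction in direction \<open>w\<close> lowers the norm to some
  \<open>p\<close> with \<open>p (- w) \<le> - norm w\<close>. A minimal functional below
  \<open>p\<close> is linear, bounded by the norm, and inherits this strict negativity.\<close>

lemma bounded_functional_nonzero:
  fixes w :: "'a::real_normed_vector"
  assumes "w \<noteq> 0"
  shows "\<exists>u :: 'a \<Rightarrow>\<^sub>L real. blinfun_apply u w \<noteq> 0"
proof -
  have "sublinear (norm :: 'a \<Rightarrow> real)"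
    by (auto simp: sublinear_def norm_triangle_ineq)
  from sublinear_slope[OF this, of w] obtain p
    where p: "sublinear p" "p \<le> norm" "\<And>x. p x \<le> norm (x + w) - norm w"
    by blast
  obtain m where m: "sublinear m" "m \<le> p" and min: "\<And>q. sublinear q \<Longrightarrow> q \<le> m \<Longrightarrow> q = m"
    using minimal_sublinear_exists[OF p(1)] by blast
  have sub: "m (x + y) \<le> m x + m y" and scale: "c \<ge> 0 \<Longrightarrow> m (c *\<^sub>R x) = c * m x" for x y c
    using m(1) by (auto simp: sublinear_def)
  have add: "m (x + y) = m x + m y" for x y
  proof -
    obtain q where q: "sublinear q" "q \<le> m" "\<And>x. q x \<le> m (x + y) - m y"
      using sublinear_slope[OF m(1), of y] by blast
    have "m x \<le> m (x + y) - m y"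
      using q(3)[of x] unfolding min[OF q(1,2)] .
    then show ?thesis
      using sub[of x y] by simp
  qed
  have minus: "m (- x) = - m x" for x
    using add[of x "- x"] sublinear_zero[OF m(1)] by simp
  have "m (c *\<^sub>R x) = c * m x" for c x
    using scale[of c x] scale[of "- c" x] minus[of "c *\<^sub>R x"] by (cases "c \<ge> 0") auto
  moreover have le: "m x \<le> norm x" for x
    using m(2) p(2) by (meson le_funD order_trans)
  then have "norm (m x) \<le> norm x * 1" for x
    using le[of x] le[of "- x"] minus[of x] by (simp add: abs_le_iff)
  ultimately have "bounded_linear m"
    using add by (intro bounded_linear_intro[where K = 1]) auto
  moreover have "m (- w) \<le> - norm w"
    using p(3)[of "- w"] m(2) by (simp add: le_fun_def) (meson order_trans)
  then have "m w \<noteq> 0"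
    using minus[of w] assms by auto
  ultimately show ?thesis
    by (metis bounded_linear_Blinfun_apply)
qed

section \<open>Simultaneous non-vanishing by Baire category\<close>

text \<open>Each set of non-vanishing is open, and dense because a zero of \<open>T n\<close> leaves
  the kernel when moved by a small multiple of a vector outside it. The lemma serves both for the
  powers of \<open>V\<close> and for evaluations on the dual space.\<close>

lemma common_nonzero_point:
  fixes T :: "nat \<Rightarrow> 'a::banach \<Rightarrow> 'b::real_normed_vector"
  assumes T: "\<And>n. bounded_linear (T n)" and ex: "\<And>n. \<exists>x. T n x \<noteq> 0"
  shows "\<exists>x. \<forall>n. T n x \<noteq> 0"
proof -
  let ?U = "\<lambda>n. {x. T n x \<noteq> 0}"
  have "open (?U n)" for n
    using T[of n] by (intro open_Collect_neq linear_continuous_on continuous_on_const)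
  moreover have "closure (?U n) = UNIV" for n
  proof -
    interpret bounded_linear "T n" by (rule T)
    obtain y where y: "T n y \<noteq> 0"
      using ex by blast
    have "x \<in> closure (?U n)" for x
    proof (cases "T n x = 0")
      case True
      have "(\<lambda>k. x + inverse (real (Suc k)) *\<^sub>R y) \<longlonglongrightarrow> x + 0 *\<^sub>R y"
        by (intro tendsto_intros LIMSEQ_inverse_real_of_nat)
      moreover have "x + inverse (real (Suc k)) *\<^sub>R y \<in> ?U n" for k
        using True y by (simp add: add scale)
      ultimately show ?thesis
        unfolding closure_sequential by (intro exI[of _ "\<lambda>k. x + inverse (real (Suc k)) *\<^sub>R y"]) simp
    qed (simp add: closure_def)
    then show ?thesis by auto
  qed
  ultimately have "euclidean closure_of \<Inter> (range ?U) = topspace (euclidean :: 'a topology)"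
    by (intro Baire_category disjI1) (auto simp: completely_metrizable_space_euclidean)
  then have "\<Inter> (range ?U) \<noteq> {}"
    by (metis UNIV_not_empty closure_of_empty topspace_euclidean)
  then show ?thesis by auto
qed

text \<open>The evaluations at the \<open>w n\<close> are bounded operators on the dual, which is
  complete even if the space itself is not.\<close>

lemma countable_separating_functional:
  fixes w :: "nat \<Rightarrow> 'a::real_normed_vector"
  assumes "\<And>n. w n \<noteq> 0"
  shows "\<exists>u :: 'a \<Rightarrow>\<^sub>L real. \<forall>n. blinfun_apply u (w n) \<noteq> 0"
proof (rule common_nonzero_point)
  show "bounded_linear (\<lambda>u :: 'a \<Rightarrow>\<^sub>L real. blinfun_apply u (w n))" for n
    by (rule blinfun.bounded_linear_left)
  show "\<exists>u :: 'a \<Rightarrow>\<^sub>L real. blinfun_apply u (w n) \<noteq> 0" for n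
    by (rule bounded_functional_nonzero) (rule assms)
qed

section \<open>Complex linear functionals\<close>

definition clinear_functional :: "('a::complex_normed_vector \<Rightarrow> complex) \<Rightarrow> bool" where
  "clinear_functional f \<longleftrightarrow> bounded_linear f \<and> (\<forall>c x. f (c *\<^sub>C x) = c * f x)"

lemma scaleR_scaleC_commute: "r *\<^sub>R c *\<^sub>C x = c *\<^sub>C r *\<^sub>R (x :: 'a::complex_vector)"
  by (metis scaleC_of_real scaleC_scaleC mult.commute)

lemma bounded_linear_scaleC: "bounded_linear (\<lambda>x :: 'a::complex_normed_vector. c *\<^sub>C x)"
  by (intro bounded_linear_intro[where K = "cmod c"])
     (auto simp: scaleC_add_right scaleR_scaleC_commute norm_scaleC mult.commute)

lemma bounded_linear_scaleC_left: "bounded_linear (\<lambda>c. c *\<^sub>C (x :: 'a::complex_normed_vector))"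
  by (intro bounded_linear_intro[where K = "norm x"])
     (simp_all add: scaleC_add_left norm_scaleC scaleR_conv_of_real scaleC_of_real flip: scaleC_scaleC)

text \<open>A real functional \<open>u\<close> is the real part of the complex linear one sending
  \<open>x\<close> to \<open>u x - \<i> * u (\<i> *\<^sub>C x)\<close>, so the latter vanishes at no
  \<open>w n\<close> either.\<close>

lemma countable_separating_clinear_functional:
  fixes w :: "nat \<Rightarrow> 'a::complex_normed_vector"
  assumes "\<And>n. w n \<noteq> 0"
  shows "\<exists>f. clinear_functional f \<and> (\<forall>n. f (w n) \<noteq> 0)"
proof -
  obtain u :: "'a \<Rightarrow>\<^sub>L real" where u: "\<And>n. blinfun_apply u (w n) \<noteq> 0"
    using countable_separating_functional[of w] assms by blast
  define f where "f x = of_real (u x) - \<i> * of_real (u (\<i> *\<^sub>C x))" for x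
  have "bounded_linear f"
    unfolding f_def
    by (intro bounded_linear_sub bounded_linear_const_mult bounded_linear_compose[OF bounded_linear_of_real]
        bounded_linear_compose[OF blinfun.bounded_linear_right] bounded_linear_scaleC bounded_linear_ident)
  moreover have "f (c *\<^sub>C x) = c * f x" for c x
  proof -
    have *: "u (d *\<^sub>C x) = Re d * u x + Im d * u (\<i> *\<^sub>C x)" for d
    proof -
      have "d *\<^sub>C x = Re d *\<^sub>R x + Im d *\<^sub>R \<i> *\<^sub>C x"
        by (subst complex_eq[of d]) (simp add: scaleC_add_left scaleC_scaleC mult.commute flip: scaleC_of_real)
      then show ?thesis
        by (simp add: blinfun.add_right blinfun.scaleR_right)
    qed
    have "u (\<i> *\<^sub>C c *\<^sub>C x) = Re c * u (\<i> *\<^sub>C x) - Im c * u x"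
      using *[of "\<i> * c"] by (simp add: scaleC_scaleC)
    with *[of c] show ?thesis
      by (simp only: f_def) (simp add: complex_eq_iff)
  qed
  moreover have "f (w n) \<noteq> 0" for n
    using u[of n] by (auto simp: f_def complex_eq_iff)
  ultimately show ?thesis
    by (auto simp: clinear_functional_def)
qed

subsection \<open>Entire functions\<close>

text \<open>Great Picard is applied to \<open>g (inverse z)\<close> at 0. A removable singularity
  there would make \<open>g\<close> constant by Liouville, and a pole would make it a
  polynomial.\<close>

lemma entire_not_polynomial_infinite_preimages:
  assumes hol: "g holomorphic_on UNIV"
    and not_poly: "\<And>(a :: nat \<Rightarrow> complex) n. \<exists>z. g z \<noteq> (\<Sum>i\<le>n. a i * z ^ i)"
  shows "\<exists>a. \<forall>w. w \<noteq> a \<longrightarrow> infinite {z. g z = w}"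
proof -
  have not_poly': "\<not> ((inverse \<circ> g) \<longlongrightarrow> l) at_infinity" for l
    using pole_at_infinity[OF hol] not_poly by metis
  have "\<not> (g \<longlongrightarrow> l) at_infinity" for l
    using Liouville_weak[OF hol, of l] not_poly[where a="\<lambda>_. l" and n = 0] by auto
  then have "\<not> ((\<lambda>z. g (inverse z)) \<longlongrightarrow> l) (at 0)" for l
    by (simp add: lim_at_infinity_0 o_def)
  moreover have "\<not> ((inverse \<circ> (\<lambda>z. g (inverse z))) \<longlongrightarrow> l) (at 0)" for l
    using not_poly'[of l] by (simp add: lim_at_infinity_0 o_def)
  moreover have "(\<lambda>z. g (inverse z)) holomorphic_on (UNIV - {0})"
    by (intro holomorphic_on_compose_gen[OF _ hol, unfolded o_def] holomorphic_intros) auto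
  ultimately obtain a where a: "\<And>w. w \<noteq> a \<Longrightarrow> infinite {x. x \<in> UNIV - {0} \<and> g (inverse x) = w}"
    using great_Picard_infinite[of UNIV 0 "\<lambda>z. g (inverse z)"] by auto
  have "infinite {z. g z = w}" if "w \<noteq> a" for w
  proof
    assume "finite {z. g z = w}"
    then have "finite (inverse ` {z. g z = w})"
      by simp
    moreover have "{x. x \<in> UNIV - {0} \<and> g (inverse x) = w} \<subseteq> inverse ` {z. g z = w}"
      by (metis (mono_tags, lifting) image_eqI inverse_inverse_eq mem_Collect_eq subsetI)
    ultimately show False
      using a[OF that] finite_subset by blast
  qed
  then show ?thesis by blast
qed

text \<open>The \<open>h n\<close> are successive remainders of one power series. Uniqueness of
  expansions reads off the coefficients without any growth estimate on \<open>c\<close>.\<close>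

lemma has_fps_expansion_of_remainders:
  fixes h :: "nat \<Rightarrow> complex \<Rightarrow> complex"
  assumes hol: "\<And>n. h n holomorphic_on UNIV"
    and step: "\<And>n z. h n z = c n + z * h (Suc n) z"
  shows "h 0 has_fps_expansion Abs_fps c"
proof -
  have exp: "h n has_fps_expansion fps_expansion (h n) 0" for n
    using hol[of n] by (intro has_fps_expansion_fps_expansion[of UNIV]) auto
  have rec: "fps_expansion (h n) 0 = fps_const (c n) + fps_X * fps_expansion (h (Suc n)) 0" for n
  proof -
    have "(\<lambda>z. c n + z * h (Suc n) z) has_fps_expansion fps_const (c n) + fps_X * fps_expansion (h (Suc n)) 0"
      by (intro fps_expansion_intros exp)
    then have "h n has_fps_expansion fps_const (c n) + fps_X * fps_expansion (h (Suc n)) 0"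
      by (simp flip: step)
    then show ?thesis
      using exp fps_expansion_unique_complex by blast
  qed
  \<comment> \<open>The index \<open>n\<close> must vary: coefficient \<open>Suc k\<close> of
    \<open>h n\<close> is coefficient \<open>k\<close> of \<open>h (Suc n)\<close>.\<close>
  have "fps_nth (fps_expansion (h n) 0) k = c (n + k)" for n k
  proof (induction k arbitrary: n)
    case 0
    show ?case by (subst rec) simp
  next
    case (Suc k)
    show ?case by (subst rec) (simp add: Suc)
  qed
  then have "fps_expansion (h 0) 0 = Abs_fps c"
    by (simp add: fps_eq_iff)
  with exp[of 0] show ?thesis
    by simp
qed

lemma polynomial_fps_nth_eventually_0:
  fixes a :: "nat \<Rightarrow> complex"
  assumes "(\<lambda>z. \<Sum>i\<le>n. a i * z ^ i) has_fps_expansion F" "n < k"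
  shows "fps_nth F k = 0"
proof -
  have "(\<lambda>z. \<Sum>i\<le>n. a i * z ^ i) has_fps_expansion (\<Sum>i\<le>n. fps_const (a i) * fps_X ^ i)"
    by (intro fps_expansion_intros)
  then have "F = (\<Sum>i\<le>n. fps_const (a i) * fps_X ^ i)"
    using assms(1) fps_expansion_unique_complex by blast
  then show ?thesis
    using assms(2) by (auto simp: fps_sum_nth intro!: sum.neutral)
qed

subsection \<open>The resolvent of a quasinilpotent operator\<close>

text \<open>\<open>R z\<close> is the inverse of \<open>I - z V\<close>; the substitution \<open>z = 1 / \<lambda>\<close> makes it entire.\<close>

locale full_resolvent =
  fixes V :: "'a::complex_banach \<Rightarrow> 'a" and R :: "complex \<Rightarrow> 'a \<Rightarrow> 'a"
  assumes V: "V \<in> cont_linear_ops" and R: "\<And>z. R z \<in> cont_linear_ops"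
    and R_left: "\<And>z x. R z (x - z *\<^sub>C V x) = x"
    and R_right: "\<And>z x. R z x - z *\<^sub>C V (R z x) = x"
begin

lemma bounded_linear_V: "bounded_linear V" and V_scaleC: "V (c *\<^sub>C x) = c *\<^sub>C V x"
  and bounded_linear_R: "bounded_linear (R z)" and R_scaleC: "R z (c *\<^sub>C x) = c *\<^sub>C R z x"
  using V R by (auto simp: cont_linear_ops_iff)

sublocale V: bounded_linear V by (rule bounded_linear_V)

sublocale R: bounded_linear "R z" for z by (rule bounded_linear_R)

text \<open>The vector \<open>V x\<close> is \<open>I - z V\<close> applied to
  \<open>V (R z x)\<close>, and \<open>R z\<close> cancels that operator.\<close>

lemma R_V_commute: "R z (V x) = V (R z x)"
proof -
  have "V x = V (R z x) - z *\<^sub>C V (V (R z x))"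
    by (subst R_right[of z x, symmetric]) (simp only: V.diff V_scaleC)
  then show ?thesis
    by (simp add: R_left)
qed

text \<open>The resolvent identity in the variable \<open>z = 1 / \<lambda>\<close>. With
  \<open>R w\<close> outermost, the fixed operator \<open>R w \<circ> V\<close> acts on the varying
  vector \<open>R z x\<close>.\<close>

lemma R_diff: "R z x - R w x = (z - w) *\<^sub>C R w (V (R z x))"
proof -
  have "x = (R z x - w *\<^sub>C V (R z x)) - (z - w) *\<^sub>C V (R z x)"
    using R_right[of z x] by (simp add: complex_vector.scale_left_diff_distrib)
  then have "R w x = R w ((R z x - w *\<^sub>C V (R z x)) - (z - w) *\<^sub>C V (R z x))"
    by (rule arg_cong)
  also have "\<dots> = R z x - (z - w) *\<^sub>C R w (V (R z x))"
    by (simp only: R.diff[of w "R z x - w *\<^sub>C V (R z x)"] R_left R_scaleC)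
  finally show ?thesis by simp
qed

text \<open>The resolvent identity bounds the difference by a multiple of
  \<open>norm (R z x)\<close>, itself unknown; for \<open>z\<close> near \<open>w\<close> this is
  absorbed and replaced by \<open>2 * norm (R w x)\<close>.\<close>

lemma R_continuous: "((\<lambda>z. R z x) \<longlongrightarrow> R w x) (at w)"
proof -
  have "bounded_linear (\<lambda>x. R w (V x))"
    by (rule bounded_linear_compose[OF bounded_linear_R bounded_linear_V])
  then obtain K where K: "K > 0" "\<And>x. norm (R w (V x)) \<le> norm x * K"
    using bounded_linear.pos_bounded by blast
  have diff: "norm (R z x - R w x) \<le> cmod (z - w) * (norm (R z x) * K)" for z
    unfolding R_diff norm_scaleC by (intro mult_left_mono K) auto
  \<comment> \<open>This radius makes the factor in front of \<open>norm (R z x)\<close> at most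
    1/2.\<close>
  have "eventually (\<lambda>z. dist z w < 1 / (2 * K)) (at w)"
    unfolding eventually_at using K(1) by (intro exI[of _ "1 / (2 * K)"]) auto
  then have ev: "eventually (\<lambda>z. norm (R z x - R w x) \<le> cmod (z - w) * (2 * norm (R w x) * K)) (at w)"
  proof eventually_elim
    case (elim z)
    then have "cmod (z - w) * (norm (R z x) * K) \<le> (1 / (2 * K)) * (norm (R z x) * K)"
      using K(1) by (intro mult_right_mono) (auto simp: dist_norm)
    then have "norm (R z x - R w x) \<le> norm (R z x) / 2"
      using diff[of z] K(1) by simp
    then have "norm (R z x) \<le> 2 * norm (R w x)"
      using norm_triangle_ineq2[of "R z x" "R w x"] by simp
    then have "cmod (z - w) * (norm (R z x) * K) \<le> cmod (z - w) * (2 * norm (R w x) * K)"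
      using K(1) by (intro mult_left_mono mult_right_mono) auto
    with diff[of z] show ?case by simp
  qed
  have "((\<lambda>z. cmod (z - w) * (2 * norm (R w x) * K)) \<longlongrightarrow> cmod (w - w) * (2 * norm (R w x) * K)) (at w)"
    by (intro tendsto_intros)
  then have "((\<lambda>z. R z x - R w x) \<longlongrightarrow> 0) (at w)"
    by (intro Lim_null_comparison[OF ev]) simp
  then show ?thesis
    by (simp add: LIM_zero_iff)
qed

context
  fixes f :: "'a \<Rightarrow> complex"
  assumes f: "clinear_functional f"
begin

lemma bounded_linear_f: "bounded_linear f" and f_scaleC: "f (c *\<^sub>C x) = c * f x"
  using f by (auto simp: clinear_functional_def)

interpretation f: bounded_linear f by (rule bounded_linear_f)

text \<open>By \<open>R_diff\<close> the difference quotient equals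
  \<open>f (R w (V (R z x)))\<close> exactly, so continuity of the resolvent gives the
  derivative.\<close>

lemma resolvent_functional_holomorphic: "(\<lambda>z. f (R z x)) holomorphic_on UNIV"
proof -
  have "((\<lambda>z. f (R z x)) has_field_derivative f (R w (V (R w x)))) (at w)" for w
  proof -
    have "((\<lambda>z. f (R w (V (R z x)))) \<longlongrightarrow> f (R w (V (R w x)))) (at w)"
      by (intro f.tendsto R.tendsto V.tendsto R_continuous)
    moreover have "f (R w (V (R z x))) = (f (R z x) - f (R w x)) / (z - w)" if "z \<noteq> w" for z
    proof -
      have "f (R z x) - f (R w x) = (z - w) * f (R w (V (R z x)))"
        by (subst f.diff[symmetric], subst R_diff) (rule f_scaleC)
      with that show ?thesis by simp
    qed
    then have "eventually (\<lambda>z. f (R w (V (R z x))) = (f (R z x) - f (R w x)) / (z - w)) (at w)"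
      by (auto simp only: eventually_at_filter intro: always_eventually)
    ultimately show ?thesis
      unfolding has_field_derivative_iff by (rule Lim_transform_eventually)
  qed
  then have "(\<lambda>z. f (R z x)) field_differentiable (at w)" for w
    unfolding field_differentiable_def by (intro exI)
  then show ?thesis
    by (simp add: holomorphic_on_def)
qed

text \<open>The remainders are \<open>f (R z ((V ^^ n) x))\<close>; their recurrence is
  \<open>R z y = y + z *\<^sub>C R z (V y)\<close> under \<open>f\<close>.\<close>

lemma resolvent_functional_has_fps_expansion:
  "(\<lambda>z. f (R z x)) has_fps_expansion Abs_fps (\<lambda>n. f ((V ^^ n) x))"
proof -
  have step: "f (R z y) = f y + z * f (R z (V y))" for z y
  proof -
    have "R z y = y + z *\<^sub>C R z (V y)"
      using R_right[of z y] by (simp add: R_V_commute algebra_simps)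
    then have "f (R z y) = f (y + z *\<^sub>C R z (V y))"
      by (rule arg_cong)
    then show ?thesis
      by (simp only: f.add f_scaleC)
  qed
  have "f (R z ((V ^^ n) x)) = f ((V ^^ n) x) + z * f (R z ((V ^^ Suc n) x))" for n z
    using step[of z "(V ^^ n) x"] by (simp only: funpow.simps o_apply)
  then have "(\<lambda>z. f (R z ((V ^^ 0) x))) has_fps_expansion Abs_fps (\<lambda>n. f ((V ^^ n) x))"
    by (intro has_fps_expansion_of_remainders resolvent_functional_holomorphic)
  then show ?thesis
    by (simp only: funpow_0)
qed

text \<open>An entire function has infinite radius of convergence. This is the decay of
  \<open>f ((V ^^ n) x)\<close> that quasinilpotency provides.\<close>

lemma resolvent_functional_summable: "summable (\<lambda>n. f ((V ^^ n) x) * z ^ n)"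
  using has_fps_expansion_imp_sums_complex[OF resolvent_functional_has_fps_expansion, of x \<infinity> z]
    holomorphic_on_subset[OF resolvent_functional_holomorphic] sums_summable by auto

end

text \<open>Otherwise \<open>(V ^^ (n * k)) x = c ^ k *\<^sub>C x\<close> with
  \<open>c \<noteq> 0\<close>, and for large \<open>r\<close> the terms of the everywhere convergent
  series at \<open>r\<close> do not tend to 0.\<close>

lemma power_not_in_span:
  assumes n: "n \<ge> 1" and x: "x \<noteq> 0" and nz: "(V ^^ n) x \<noteq> 0"
  shows "(V ^^ n) x \<noteq> c *\<^sub>C x"
proof
  assume eq: "(V ^^ n) x = c *\<^sub>C x"
  have "c \<noteq> 0"
    using eq nz by auto
  obtain f where f: "clinear_functional f" "f x \<noteq> 0"
    using countable_separating_clinear_functional[of "\<lambda>_. x"] x by auto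
  have Vscale: "(V ^^ m) (c *\<^sub>C y) = c *\<^sub>C (V ^^ m) y" for m c y
    by (induction m) (simp_all add: V_scaleC)
  have pow: "(V ^^ (n * k)) x = c ^ k *\<^sub>C x" for k
  proof (induction k)
    case (Suc k)
    have "(V ^^ (n * Suc k)) x = (V ^^ (n * k)) ((V ^^ n) x)"
      by (simp only: mult_Suc_right add.commute[of n] funpow_add o_apply)
    also have "\<dots> = c ^ Suc k *\<^sub>C x"
      by (simp only: eq Vscale Suc.IH scaleC_scaleC power_Suc)
    finally show ?case .
  qed simp
  \<comment> \<open>Taking \<open>r \<ge> 1\<close> gives \<open>r \<le> r ^ n\<close>, so
    \<open>cmod c * r ^ n \<ge> 1\<close> is reached without extracting a root.\<close>
  define r where "r = max 1 (1 / cmod c)"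
  have r: "r \<ge> 1" "1 / cmod c \<le> r"
    by (simp_all add: r_def)
  have "r \<le> r ^ n"
    using n r(1) by (simp add: self_le_power)
  with r(2) have "1 / cmod c \<le> r ^ n"
    by (rule order_trans)
  then have "1 \<le> cmod c * r ^ n"
    using \<open>c \<noteq> 0\<close> by (simp add: pos_divide_le_eq mult.commute)
  then have ge: "cmod (f x) \<le> cmod (f ((V ^^ (n * k)) x) * of_real r ^ (n * k))" for k
  proof -
    have "cmod (f ((V ^^ (n * k)) x) * of_real r ^ (n * k)) = (cmod c * r ^ n) ^ k * cmod (f x)"
      using r(1) by (simp add: pow f_scaleC[OF f(1)] norm_mult norm_power power_mult power_mult_distrib)
    moreover have "1 * cmod (f x) \<le> (cmod c * r ^ n) ^ k * cmod (f x)"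
      using \<open>1 \<le> cmod c * r ^ n\<close> by (intro mult_right_mono one_le_power) auto
    ultimately show ?thesis
      by simp
  qed
  have "(\<lambda>m. f ((V ^^ m) x) * of_real r ^ m) \<longlonglongrightarrow> 0"
    by (rule summable_LIMSEQ_zero[OF resolvent_functional_summable[OF f(1)]])
  moreover have "strict_mono (\<lambda>k. n * k)"
    using n by (auto simp: strict_mono_def)
  ultimately have "(\<lambda>k. f ((V ^^ (n * k)) x) * of_real r ^ (n * k)) \<longlonglongrightarrow> 0"
    by (rule LIMSEQ_subseq_LIMSEQ[unfolded o_def])
  then have "cmod (f x) \<le> 0"
    using ge LIMSEQ_le_const[OF tendsto_norm_zero] by blast
  with f(2) show False by simp
qed

end

subsection \<open>The perturbation\<close>

text \<open>For \<open>z \<noteq> 0\<close>, \<open>I - z V\<close> is \<open>z\<close> times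
  \<open>inverse z I - V\<close>, invertible because \<open>inverse z\<close> is a nonzero number;
  at \<open>z = 0\<close> the inverse is the identity.\<close>

lemma quasinilpotent_full_resolvent:
  fixes V :: "'a::complex_banach \<Rightarrow> 'a"
  assumes V: "V \<in> cont_linear_ops" and q: "quasinilpotent V"
  shows "\<exists>R. full_resolvent V R"
proof -
  have scale: "bounded_linear (\<lambda>x::'a. c *\<^sub>C x)" for c by (rule bounded_linear_scaleC)
  have "\<exists>S\<in>cont_linear_ops. (\<forall>x. S (x - z *\<^sub>C V x) = x) \<and> (\<forall>x. S x - z *\<^sub>C V (S x) = x)" for z
  proof (cases "z = 0")
    case True
    then show ?thesis
      by (intro bexI[of _ id]) (auto simp: cont_linear_ops_iff id_def bounded_linear_ident)
  next
    case False
    then have "inverse z \<notin> spectrum_op V"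
      using q by (simp add: quasinilpotent_def)
    then obtain S where S: "S \<in> cont_linear_ops"
      and left: "\<And>x. S (inverse z *\<^sub>C x - V x) = x" and right: "\<And>x. inverse z *\<^sub>C S x - V (S x) = x"
      by (auto simp: spectrum_op_def invertible_op_def fun_eq_iff)
    have S_scale: "S (c *\<^sub>C x) = c *\<^sub>C S x" for c x
      using S by (simp add: cont_linear_ops_iff)
    have V_scale: "V (c *\<^sub>C x) = c *\<^sub>C V x" for c x
      using V by (simp add: cont_linear_ops_iff)
    let ?S = "\<lambda>x. inverse z *\<^sub>C S x"
    have "bounded_linear ?S"
      using S by (intro bounded_linear_compose[OF scale]) (simp add: cont_linear_ops_iff)
    then have "?S \<in> cont_linear_ops"
      by (simp add: cont_linear_ops_iff S_scale mult.commute)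
    moreover have "?S (x - z *\<^sub>C V x) = x" for x
    proof -
      have "inverse z *\<^sub>C (x - z *\<^sub>C V x) = inverse z *\<^sub>C x - V x"
        using False by (simp add: complex_vector.scale_right_diff_distrib)
      then show ?thesis
        using left[of x] by (simp flip: S_scale)
    qed
    moreover have "?S x - z *\<^sub>C V (?S x) = x" for x
      using right[of x] False by (simp add: V_scale)
    ultimately show ?thesis
      by (intro bexI[of _ ?S] conjI allI)
  qed
  then obtain R where "\<And>z. R z \<in> cont_linear_ops" "\<And>z x. R z (x - z *\<^sub>C V x) = x"
    "\<And>z x. R z x - z *\<^sub>C V (R z x) = x"
    by metis
  with V show ?thesis
    by (auto simp: full_resolvent_def)
qed

text \<open>Baire is applied to the powers from 1 on, those that \<open>nilpotent_op\<close> speaks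
  of; power 0 follows since \<open>V x \<noteq> 0\<close> forces
  \<open>x \<noteq> 0\<close>.\<close>

lemma non_nilpotent_orbit:
  fixes V :: "'a::complex_banach \<Rightarrow> 'a"
  assumes V: "V \<in> cont_linear_ops" and nn: "\<not> nilpotent_op V"
  shows "\<exists>x. \<forall>n. (V ^^ n) x \<noteq> 0"
proof -
  have V0: "V 0 = 0" and bl: "bounded_linear V"
    using V by (auto simp: cont_linear_ops_iff bounded_linear.axioms linear_0 bounded_linear.linear)
  have "bounded_linear (V ^^ Suc n)" for n
  proof (induction n)
    case (Suc n)
    show ?case
      using bounded_linear_compose[OF bl Suc] by (simp add: o_def)
  qed (simp add: bl)
  moreover have "\<exists>x. (V ^^ Suc n) x \<noteq> 0" for n
    using nn by (auto simp: nilpotent_op_def fun_eq_iff simp del: funpow.simps)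
  ultimately obtain x where x: "\<And>n. (V ^^ Suc n) x \<noteq> 0"
    using common_nonzero_point[of "\<lambda>n. V ^^ Suc n"] by blast
  moreover have "x \<noteq> 0"
    using x[of 0] V0 by auto
  ultimately have "(V ^^ n) x \<noteq> 0" for n
    by (cases n) auto
  then show ?thesis by blast
qed

text \<open>The projection \<open>P\<close> along \<open>x\<close> kills exactly the multiples of
  \<open>x\<close>. A functional separating the \<open>P (w n)\<close> from 0 is pulled back along
  \<open>P\<close>.\<close>

lemma clinear_functional_annihilating:
  fixes x :: "'a::complex_normed_vector"
  assumes x: "x \<noteq> 0" and w: "\<And>n c. w n \<noteq> c *\<^sub>C x"
  shows "\<exists>f. clinear_functional f \<and> f x = 0 \<and> (\<forall>n::nat. f (w n) \<noteq> 0)"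
proof -
  obtain e where e: "clinear_functional e" "e x \<noteq> 0"
    using countable_separating_clinear_functional[of "\<lambda>_. x"] x by auto
  define P where "P y = y - (e y / e x) *\<^sub>C x" for y
  have e_scale: "e (c *\<^sub>C y) = c * e y" for c y
    using e(1) by (simp add: clinear_functional_def)
  have "P (w n) \<noteq> 0" for n
    using w[of n] by (simp add: P_def)
  then obtain g where g: "clinear_functional g" "\<And>n. g (P (w n)) \<noteq> 0"
    using countable_separating_clinear_functional[of "\<lambda>n. P (w n)"] by blast
  have "bounded_linear P"
    unfolding P_def using e(1)
    by (intro bounded_linear_sub bounded_linear_ident bounded_linear_compose[OF bounded_linear_scaleC_left]
        bounded_linear_divide[THEN bounded_linear_compose]) (auto simp: clinear_functional_def)
  then have "bounded_linear (\<lambda>y. g (P y))"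
    using g(1) by (auto simp: clinear_functional_def intro: bounded_linear_compose)
  moreover have "P (c *\<^sub>C y) = c *\<^sub>C P y" for c y
    by (simp add: P_def e_scale complex_vector.scale_right_diff_distrib)
  then have "g (P (c *\<^sub>C y)) = c * g (P y)" for c y
    using g(1) by (simp add: clinear_functional_def)
  moreover have "P x = 0"
    using e(2) by (simp add: P_def scaleC_one)
  then have "g (P x) = 0"
    using g(1) by (simp add: clinear_functional_def linear_0 bounded_linear.linear)
  ultimately show ?thesis
    using g(2) by (intro exI[of _ "\<lambda>y. g (P y)"]) (auto simp: clinear_functional_def)
qed

lemma rank_one_scaleC:
  fixes x :: "'a::complex_normed_vector"
  assumes f: "clinear_functional f" and "f y \<noteq> 0" "x \<noteq> 0"
  shows "(\<lambda>v. f v *\<^sub>C x) \<in> cont_linear_ops" "rank_one (\<lambda>v. f v *\<^sub>C x)"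
proof -
  have f_scale: "f (c *\<^sub>C v) = c * f v" for c v
    using f by (simp add: clinear_functional_def)
  show "(\<lambda>v. f v *\<^sub>C x) \<in> cont_linear_ops"
    using f by (auto simp: cont_linear_ops_iff clinear_functional_def scaleC_scaleC
        intro: bounded_linear_compose[OF bounded_linear_scaleC_left])
  have "range (\<lambda>v. f v *\<^sub>C x) = complex_vector.span {x}"
  proof -
    have "c *\<^sub>C x = f ((c / f y) *\<^sub>C y) *\<^sub>C x" for c
      using assms(2) by (simp add: f_scale)
    then show ?thesis
      unfolding complex_vector.span_singleton by blast
  qed
  then show "rank_one (\<lambda>v. f v *\<^sub>C x)"
    using \<open>x \<noteq> 0\<close> complex_vector.dim_eq_card_independent[of "{x}"]
    by (simp add: rank_one_def)
qed

text \<open>The vector \<open>R z x\<close> is an eigenvector of the perturbed operator with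
  eigenvalue \<open>inverse z\<close>.\<close>

lemma (in full_resolvent) inverse_in_spectrum_perturbation:
  assumes x: "x \<noteq> 0" and eq: "\<alpha> * (z * f (R z x)) = 1"
  shows "inverse z \<in> spectrum_op (\<lambda>y. V y + \<alpha> *\<^sub>C f y *\<^sub>C x)"
proof -
  let ?y = "R z x" and ?T = "\<lambda>y. inverse z *\<^sub>C y - (V y + \<alpha> *\<^sub>C f y *\<^sub>C x)"
  have z: "z \<noteq> 0"
    using eq by auto
  have "inverse z *\<^sub>C ?y - V ?y = inverse z *\<^sub>C (?y - z *\<^sub>C V ?y)"
    using z by (simp add: complex_vector.scale_right_diff_distrib)
  also have "\<dots> = inverse z *\<^sub>C x"
    by (simp only: R_right)
  also have "\<dots> = (\<alpha> * f ?y) *\<^sub>C x"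
    using eq z by (simp add: field_simps)
  finally have "?T ?y = 0"
    by (simp add: diff_diff_eq[symmetric])
  moreover have "?y \<noteq> 0"
    using x R_right[of z x] by auto
  moreover have "S 0 = 0" if "S \<in> cont_linear_ops" for S :: "'a \<Rightarrow> 'a"
    using that by (simp add: cont_linear_ops_iff bounded_linear.linear linear_0)
  ultimately have "S (?T ?y) \<noteq> ?y" if "S \<in> cont_linear_ops" for S
    using that by metis
  then have "\<not> invertible_op ?T"
    unfolding invertible_op_def by (auto simp: fun_eq_iff)
  then show ?thesis
    by (simp add: spectrum_op_def)
qed

theorem theorem1p1:
  fixes V :: "'a::complex_banach \<Rightarrow> 'a"
  assumes "infinite_dimensional TYPE('a)"
    and "V \<in> cont_linear_ops"
    and "quasinilpotent V"
    and "\<not> nilpotent_op V"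
  shows "\<exists>Q\<in>cont_linear_ops. rank_one Q \<and> Q \<circ> Q = (\<lambda>x. 0) \<and>
    (\<exists>\<^sub>\<le>\<^sub>1 \<alpha>. \<alpha> \<noteq> 0 \<and> \<not> infinite (spectrum_op (\<lambda>x. V x + \<alpha> *\<^sub>C Q x)))"
proof -
  obtain R where "full_resolvent V R"
    using quasinilpotent_full_resolvent assms(2,3) by blast
  then interpret full_resolvent V R .
  obtain x where x: "\<And>n. (V ^^ n) x \<noteq> 0"
    using non_nilpotent_orbit assms(2,4) by blast
  have x0: "x \<noteq> 0"
    using x[of 0] by simp
  obtain f where f: "clinear_functional f" "f x = 0" "\<And>n. f ((V ^^ Suc n) x) \<noteq> 0"
    using clinear_functional_annihilating[OF x0, of "\<lambda>n. (V ^^ Suc n) x"] power_not_in_span[OF _ x0 x]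
    by (metis le_add1 plus_1_eq_Suc)
  define g where "g z = z * f (R z x)" for z
  have "g holomorphic_on UNIV"
    unfolding g_def by (intro holomorphic_intros resolvent_functional_holomorphic f(1))
  moreover have "\<exists>z. g z \<noteq> (\<Sum>i\<le>n. a i * z ^ i)" for a n
  proof (rule ccontr)
    assume "\<not> ?thesis"
    then have "(\<lambda>z. \<Sum>i\<le>n. a i * z ^ i) = g"
      by auto
    moreover have "g has_fps_expansion fps_X * Abs_fps (\<lambda>n. f ((V ^^ n) x))"
      unfolding g_def by (intro fps_expansion_intros resolvent_functional_has_fps_expansion f(1))
    \<comment> \<open>The factor \<open>fps_X\<close> shifts indices by one, so this coefficient is
      \<open>f ((V ^^ Suc n) x)\<close>. Index \<open>Suc n\<close> would not do: for
      \<open>n = 0\<close> it gives \<open>f x = 0\<close>.\<close>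
    ultimately have "fps_nth (fps_X * Abs_fps (\<lambda>n. f ((V ^^ n) x))) (Suc (Suc n)) = 0"
      by (intro polynomial_fps_nth_eventually_0[of a n]) auto
    then show False
      using f(3)[of n] by simp
  qed
  ultimately obtain a where a: "\<And>w. w \<noteq> a \<Longrightarrow> infinite {z. g z = w}"
    using entire_not_polynomial_infinite_preimages by metis
  define Q where "Q y = f y *\<^sub>C x" for y
  have exceptional: "inverse \<alpha> = a"
    if \<alpha>: "\<alpha> \<noteq> 0" and fin: "finite (spectrum_op (\<lambda>y. V y + \<alpha> *\<^sub>C Q y))" for \<alpha>
  proof (rule ccontr)
    assume "inverse \<alpha> \<noteq> a"
    \<comment> \<open>Inversion is injective, so infinitely many solutions \<open>z\<close> yield
      infinitely many distinct spectral points.\<close>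
    then have "infinite (inverse ` {z. g z = inverse \<alpha>})"
      using a by (subst finite_image_iff) (auto simp: inj_on_def)
    moreover have "inverse z \<in> spectrum_op (\<lambda>y. V y + \<alpha> *\<^sub>C Q y)" if "g z = inverse \<alpha>" for z
      unfolding Q_def using that \<alpha> by (intro inverse_in_spectrum_perturbation x0) (simp add: g_def)
    then have "inverse ` {z. g z = inverse \<alpha>} \<subseteq> spectrum_op (\<lambda>y. V y + \<alpha> *\<^sub>C Q y)"
      by blast
    ultimately show False
      using fin finite_subset by blast
  qed
  have "Q \<in> cont_linear_ops" "rank_one Q"
    using rank_one_scaleC[OF f(1) f(3)[of 0] x0] by (simp_all add: Q_def[abs_def])
  moreover have "Q \<circ> Q = (\<lambda>y. 0)"
    using f(1,2) by (simp add: Q_def fun_eq_iff clinear_functional_def)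
  \<comment> \<open>Every exceptional \<alpha> has inverse \<open>a\<close>, the single Picard
    exceptional value, so two of them coincide.\<close>
  moreover have "\<exists>\<^sub>\<le>\<^sub>1 \<alpha>. \<alpha> \<noteq> 0 \<and> \<not> infinite (spectrum_op (\<lambda>x. V x + \<alpha> *\<^sub>C Q x))"
    unfolding Uniq_def using exceptional by (metis inverse_inverse_eq)
  ultimately show ?thesis by blast
qed

end
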